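(* For any $K>0$ there are $n>0$ and a monotone Boolean function $F:\{-1,1\}^{n+1}\to\{-1,1\}$ such that, when $F$ is split by the last variable $x_{n+1}$ into $F^{\pm}$, $$\sum_{S\subset[n]}\big|\widehat{F^+}(S)^2-\widehat{F^-}(S)^2\big|>K\sum_{S\subset[n]}\big|\widehat{F^+}(S)-\widehat{F^-}(S)\big|^2.$$
   Context: $[n]=\{1,\dots,n\}$. A Boolean function $F:\{-1,1\}^{N}\to\{-1,1\}$ is monotone if $F(x)\le F(y)$ whenever $x_i\le y_i$ for all $i$. $F^{\pm}:\{-1,1\}^n\to\{-1,1\}$ are defined by $F^{\pm}(x)=F(x,\pm1)$. For $f:\{-1,1\}^n\to\mathbb R$ and $S\subset[n]$, $\widehat f(S)=2^{-n}\sum_{x}f(x)\prod_{i\in S}x_i$. *)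

theory Defs
  imports Complex_Main "HOL-Library.FuncSet"
begin

text \<open>Points of the cube are extensional functions (\<open>undefined\<close> outside \<open>{1..n}\<close>), so
  the set below is finite with exactly \<open>2 ^ n\<close> elements and sums over it are genuine.\<close>

definition cube :: "nat \<Rightarrow> (nat \<Rightarrow> real) set" where
  "cube n = {1..n} \<rightarrow>\<^sub>E {-1, 1}"

definition boolean_function :: "nat \<Rightarrow> ((nat \<Rightarrow> real) \<Rightarrow> real) \<Rightarrow> bool" where
  "boolean_function n F \<longleftrightarrow> F \<in> cube n \<rightarrow> {-1, 1}"

definition monotone_boolean_function :: "nat \<Rightarrow> ((nat \<Rightarrow> real) \<Rightarrow> real) \<Rightarrow> bool" where
  "monotone_boolean_function n F \<longleftrightarrow> boolean_function n F \<and>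
     (\<forall>x\<in>cube n. \<forall>y\<in>cube n. (\<forall>i\<in>{1..n}. x i \<le> y i) \<longrightarrow> F x \<le> F y)"

text \<open>For a function \<open>F\<close> on \<open>cube (n + 1)\<close>, the two restrictions are functions on \<open>cube n\<close>:
  updating a point of \<open>cube n\<close> at the index \<open>n + 1\<close> appends a last coordinate.\<close>

definition restrict_plus :: "nat \<Rightarrow> ((nat \<Rightarrow> real) \<Rightarrow> real) \<Rightarrow> (nat \<Rightarrow> real) \<Rightarrow> real" where
  "restrict_plus n F = (\<lambda>x. F (x(n + 1 := 1)))"

definition restrict_minus :: "nat \<Rightarrow> ((nat \<Rightarrow> real) \<Rightarrow> real) \<Rightarrow> (nat \<Rightarrow> real) \<Rightarrow> real" where
  "restrict_minus n F = (\<lambda>x. F (x(n + 1 := -1)))"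

definition fourier_coeff :: "nat \<Rightarrow> ((nat \<Rightarrow> real) \<Rightarrow> real) \<Rightarrow> nat set \<Rightarrow> real" where
  "fourier_coeff n f S = (\<Sum>x\<in>cube n. f x * (\<Prod>i\<in>S. x i)) / 2 ^ n"

end

theory Submission
  imports Defs
begin

text \<open>
  Write \<open>\<parallel>f\<parallel>\<close> for the spectral norm \<open>\<Sum>S. \<bar>fourier_coeff n f S\<bar>\<close>.  Let \<open>f\<close> be monotone and let \<open>p\<close> be a
  minimal point of \<open>{x. f x = 1}\<close>.  Lowering the value at \<open>p\<close> to \<open>-1\<close> keeps \<open>f\<close> monotone, so \<open>f\<close>
  and the lowered function are the two halves \<open>F\<^sup>+\<close> and \<open>F\<^sup>-\<close> of a monotone \<open>F\<close>.  The difference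
  \<open>F\<^sup>+ - F\<^sup>-\<close> is twice a point mass, whose Fourier spectrum is perfectly flat: every coefficient is
  \<open>\<plusminus>2 / 2 ^ n\<close>.  Hence the sum of the squared differences is \<open>4 / 2 ^ n\<close>, whereas
  \<open>\<bar>a\<^sup>2 - b\<^sup>2\<bar> = \<bar>a - b\<bar> \<bar>a + b\<bar>\<close> turns the other sum into \<open>2 / 2 ^ n\<close> times the spectral norm of
  \<open>F\<^sup>+ + F\<^sup>-\<close>, which is at least \<open>2 \<parallel>f\<parallel> - 2\<close>.  The ratio is thus at least \<open>\<parallel>f\<parallel> - 1\<close>
  (\<open>split_at_minimal_true_point\<close>), and it remains to find monotone functions of unbounded spectral
  norm.

  Splitting by the last variable gives \<open>\<parallel>f\<parallel> = \<Sum>S. max \<bar>a S\<bar> \<bar>b S\<bar>\<close>, where \<open>a\<close> and \<open>b\<close> are the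
  spectra of the two halves (\<open>spectral_norm_Suc\<close>).  If one half is a constant \<open>\<plusminus>1\<close> and the other
  is \<open>g\<close>, this is \<open>\<parallel>g\<parallel> + 1 - \<bar>mean of g\<bar>\<close>.  A decision list that alternately forces the values
  \<open>1\<close> and \<open>-1\<close> keeps its mean in \<open>[-1/2, 1/2]\<close> from the first variable on, so that every further variable
  adds at least \<open>1/2\<close> to the norm (\<open>spectral_norm_alternating_list\<close>).
\<close>

section \<open>Splitting the cube by the last variable\<close>

lemma finite_cube [simp]: "finite (cube n)"
  by (simp add: cube_def finite_PiE)

lemma cube_values: "x \<in> cube n \<Longrightarrow> i \<in> {1..n} \<Longrightarrow> x i = 1 \<or> x i = -1"
  by (auto simp: cube_def PiE_iff)

lemma cube_outside: "x \<in> cube n \<Longrightarrow> i \<notin> {1..n} \<Longrightarrow> x i = undefined"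
  unfolding cube_def by (rule PiE_arb)

lemma cube_update: "x \<in> cube n \<Longrightarrow> s \<in> {1, -1} \<Longrightarrow> x(Suc n := s) \<in> cube (Suc n)"
  by (auto simp: cube_def PiE_iff extensional_def le_Suc_eq)

lemma cube_restrict: "x \<in> cube (Suc n) \<Longrightarrow> restrict x {1..n} \<in> cube n"
  by (auto simp: cube_def PiE_iff)

lemma restrict_cube_update: "x \<in> cube n \<Longrightarrow> restrict (x(Suc n := s)) {1..n} = x"
  by (auto simp: fun_eq_iff restrict_def cube_outside)

lemma sum_cube_Suc:
  fixes g :: "(nat \<Rightarrow> real) \<Rightarrow> real"
  shows "(\<Sum>x\<in>cube (Suc n). g x) = (\<Sum>x\<in>cube n. g (x(Suc n := 1)) + g (x(Suc n := -1)))"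
proof -
  have "(\<Sum>x\<in>cube (Suc n). g x) = (\<Sum>(x, s)\<in>cube n \<times> {1, -1}. g (x(Suc n := s)))"
  proof (rule sum.reindex_bij_witness[where
        j = "\<lambda>x. (restrict x {1..n}, x (Suc n))" and i = "\<lambda>(x, s). x(Suc n := s)"])
    fix x assume x: "x \<in> cube (Suc n)"
    show *: "(case (restrict x {1..n}, x (Suc n)) of (x, s) \<Rightarrow> x(Suc n := s)) = x"
      using cube_outside[OF x] by (auto simp: fun_eq_iff restrict_def)
    show "(restrict x {1..n}, x (Suc n)) \<in> cube n \<times> {1, -1}"
      using cube_restrict[OF x] cube_values[OF x, of "Suc n"] by auto
    show "(case (restrict x {1..n}, x (Suc n)) of (x, s) \<Rightarrow> g (x(Suc n := s))) = g x"
      using * by simp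
  next
    fix q assume "q \<in> cube n \<times> {1, -1 :: real}"
    then obtain x s where q: "q = (x, s)" "x \<in> cube n" "s \<in> {1, -1}" by auto
    show "(restrict (case q of (x, s) \<Rightarrow> x(Suc n := s)) {1..n}, (case q of (x, s) \<Rightarrow> x(Suc n := s)) (Suc n)) = q"
      using q restrict_cube_update[OF q(2)] by simp
    show "(case q of (x, s) \<Rightarrow> x(Suc n := s)) \<in> cube (Suc n)"
      using q cube_update by auto
  qed
  also have "\<dots> = (\<Sum>x\<in>cube n. \<Sum>s\<in>{1, -1}. g (x(Suc n := s)))"
    by (simp only: sum.cartesian_product)
  finally show ?thesis by simp
qed

lemma sum_Pow_Suc:
  fixes g :: "nat set \<Rightarrow> real"
  shows "(\<Sum>S\<in>Pow {1..Suc n}. g S) = (\<Sum>S\<in>Pow {1..n}. g S + g (insert (Suc n) S))"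
proof -
  have Pow_eq: "Pow {1..Suc n} = Pow {1..n} \<union> insert (Suc n) ` Pow {1..n}"
    using atLeastAtMostSuc_conv[of 1 n] by (simp only: Pow_insert)
  have inj: "inj_on (insert (Suc n)) (Pow {1..n})"
  proof (rule inj_onI)
    fix S T assume ST: "S \<in> Pow {1..n}" "T \<in> Pow {1..n}"
      and eq: "insert (Suc n) S = insert (Suc n) T"
    have "Suc n \<notin> S" "Suc n \<notin> T" using ST by auto
    from insert_ident[OF this] eq show "S = T" by (rule iffD1)
  qed
  have "(\<Sum>S\<in>Pow {1..Suc n}. g S)
      = (\<Sum>S\<in>Pow {1..n}. g S) + (\<Sum>S\<in>insert (Suc n) ` Pow {1..n}. g S)"
    unfolding Pow_eq by (rule sum.union_disjoint) auto
  also have "(\<Sum>S\<in>insert (Suc n) ` Pow {1..n}. g S) = (\<Sum>S\<in>Pow {1..n}. g (insert (Suc n) S))"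
    using sum.reindex[OF inj] by (simp only: comp_def)
  finally show ?thesis by (simp only: sum.distrib)
qed

lemma prod_update_fresh:
  fixes x :: "nat \<Rightarrow> real"
  assumes "S \<subseteq> {1..n}"
  shows "(\<Prod>i\<in>S. (x(Suc n := s)) i) = (\<Prod>i\<in>S. x i)"
  by (rule prod.cong) (use assms in auto)

lemma fourier_coeff_Suc:
  assumes S: "S \<subseteq> {1..n}"
  shows "fourier_coeff (Suc n) f S
           = (fourier_coeff n (restrict_plus n f) S + fourier_coeff n (restrict_minus n f) S) / 2"
    and "fourier_coeff (Suc n) f (insert (Suc n) S)
           = (fourier_coeff n (restrict_plus n f) S - fourier_coeff n (restrict_minus n f) S) / 2"
proof -
  have fresh: "finite S" "Suc n \<notin> S" using S finite_subset by auto
  show "fourier_coeff (Suc n) f S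
           = (fourier_coeff n (restrict_plus n f) S + fourier_coeff n (restrict_minus n f) S) / 2"
    unfolding fourier_coeff_def sum_cube_Suc restrict_plus_def restrict_minus_def
      prod_update_fresh[OF S] sum.distrib
    by (simp add: add_divide_distrib)
  show "fourier_coeff (Suc n) f (insert (Suc n) S)
           = (fourier_coeff n (restrict_plus n f) S - fourier_coeff n (restrict_minus n f) S) / 2"
    unfolding fourier_coeff_def sum_cube_Suc restrict_plus_def restrict_minus_def
      prod.insert[OF fresh] prod_update_fresh[OF S] sum.distrib
    by (simp add: sum_negf diff_divide_distrib)
qed

lemma fourier_coeff_cong:
  assumes "\<And>x. x \<in> cube n \<Longrightarrow> f x = g x"
  shows "fourier_coeff n f S = fourier_coeff n g S"
  unfolding fourier_coeff_def using assms by simp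

lemma fourier_coeff_const:
  "S \<subseteq> {1..n} \<Longrightarrow> fourier_coeff n (\<lambda>_. c) S = (if S = {} then c else 0)"
proof (induction n arbitrary: S)
  case 0
  then show ?case by (simp add: fourier_coeff_def cube_def)
next
  case (Suc n)
  have halves: "restrict_plus n (\<lambda>_. c) = (\<lambda>_. c)" "restrict_minus n (\<lambda>_. c) = (\<lambda>_. c)"
    by (simp_all add: restrict_plus_def restrict_minus_def)
  show ?case
  proof (cases "Suc n \<in> S")
    case True
    then obtain T where T: "S = insert (Suc n) T" "Suc n \<notin> T" using mk_disjoint_insert[OF True] by auto
    then have "T \<subseteq> {1..n}" using Suc.prems by (auto simp: atLeastAtMostSuc_conv)
    with T(1) show ?thesis by (simp add: fourier_coeff_Suc(2) halves)
  next
    case False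
    then have "S \<subseteq> {1..n}" using Suc.prems by (auto simp: atLeastAtMostSuc_conv)
    then show ?thesis by (simp add: fourier_coeff_Suc(1) halves Suc.IH)
  qed
qed

section \<open>Monotone functions of large spectral norm\<close>

definition spectral_norm :: "nat \<Rightarrow> ((nat \<Rightarrow> real) \<Rightarrow> real) \<Rightarrow> real" where
  "spectral_norm n f = (\<Sum>S\<in>Pow {1..n}. \<bar>fourier_coeff n f S\<bar>)"

text \<open>The coefficients at \<open>S\<close> and at \<open>insert (Suc n) S\<close> are half the sum and half the difference of
  those of the two halves, and \<open>\<bar>a + b\<bar> + \<bar>a - b\<bar> = 2 max \<bar>a\<bar> \<bar>b\<bar>\<close>.\<close>

lemma spectral_norm_Suc:
  "spectral_norm (Suc n) f = (\<Sum>S\<in>Pow {1..n}.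
     max \<bar>fourier_coeff n (restrict_plus n f) S\<bar> \<bar>fourier_coeff n (restrict_minus n f) S\<bar>)"
proof -
  have max_eq: "\<bar>(a + b) / 2\<bar> + \<bar>(a - b) / 2\<bar> = max \<bar>a\<bar> \<bar>b\<bar>" for a b :: real
    by (simp add: abs_if max_def add_divide_distrib diff_divide_distrib)
  show ?thesis
    unfolding spectral_norm_def sum_Pow_Suc
    by (rule sum.cong) (simp_all only: Pow_iff fourier_coeff_Suc max_eq)
qed

text \<open>The spectrum of a constant \<open>\<plusminus>1\<close> is a unit mass at the empty set, so the maximum differs from
  the spectrum of \<open>g\<close> only there, where the mean of \<open>g\<close> is replaced by \<open>1\<close>.\<close>

lemma sum_max_unit_mass:
  assumes "\<bar>fourier_coeff n g {}\<bar> \<le> 1" "\<bar>c\<bar> = 1"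
  shows "(\<Sum>S\<in>Pow {1..n}. max \<bar>fourier_coeff n (\<lambda>_. c) S\<bar> \<bar>fourier_coeff n g S\<bar>)
           = spectral_norm n g + 1 - \<bar>fourier_coeff n g {}\<bar>"
proof -
  have "(\<Sum>S\<in>Pow {1..n}. max \<bar>fourier_coeff n (\<lambda>_. c) S\<bar> \<bar>fourier_coeff n g S\<bar>)
      = (\<Sum>S\<in>Pow {1..n}. \<bar>fourier_coeff n g S\<bar>
                          + (if S = {} then 1 - \<bar>fourier_coeff n g {}\<bar> else 0))"
    by (rule sum.cong) (use assms in \<open>auto simp: fourier_coeff_const\<close>)
  also have "\<dots> = spectral_norm n g + (1 - \<bar>fourier_coeff n g {}\<bar>)"
    unfolding sum.distrib spectral_norm_def by (simp add: sum.delta)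
  finally show ?thesis by simp
qed

text \<open>The decision list that reads the variables from the last one down and stops at the first
  \<open>i\<close> with \<open>x i = (-1) ^ (i - 1)\<close>, returning that sign.  As the returned value equals the value that
  triggers it, each step is a disjunction or a conjunction with one variable.
  With the default \<open>-1\<close> the list of length \<open>1\<close> is \<open>x 1\<close> itself, which has mean \<open>0\<close>.\<close>

fun alternating_list :: "nat \<Rightarrow> (nat \<Rightarrow> real) \<Rightarrow> real" where
  "alternating_list 0 x = -1"
| "alternating_list (Suc n) x = (if x (Suc n) = (-1) ^ n then (-1) ^ n else alternating_list n x)"

lemma alternating_list_values: "alternating_list n x \<in> {-1, 1}"
proof (induction n)
  case (Suc n)
  then show ?case using minus_one_power_iff[of n, where 'a = real] by auto
qed simp

lemma alternating_list_update: "n < m \<Longrightarrow> alternating_list n (x(m := s)) = alternating_list n x"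
  by (induction n) auto

lemma alternating_list_mono:
  assumes "\<And>i. i \<in> {1..n} \<Longrightarrow> x i \<le> y i"
    and "\<And>i. i \<in> {1..n} \<Longrightarrow> x i \<in> {-1, 1}" "\<And>i. i \<in> {1..n} \<Longrightarrow> y i \<in> {-1, 1}"
  shows "alternating_list n x \<le> alternating_list n y"
  using assms
proof (induction n)
  case (Suc n)
  have IH: "alternating_list n x \<le> alternating_list n y"
    by (rule Suc.IH) (use Suc.prems in auto)
  have last: "x (Suc n) \<le> y (Suc n)" "x (Suc n) \<in> {-1, 1}" "y (Suc n) \<in> {-1, 1}"
    using Suc.prems by auto
  show ?case
    using IH last alternating_list_values[of n x] alternating_list_values[of n y]
    by (cases "even n") auto
qed simp

lemma monotone_alternating_list: "monotone_boolean_function n (alternating_list n)"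
  unfolding monotone_boolean_function_def boolean_function_def
proof (intro conjI ballI impI)
  show "alternating_list n \<in> cube n \<rightarrow> {-1, 1}" using alternating_list_values by blast
  fix x y assume "x \<in> cube n" "y \<in> cube n" "\<forall>i\<in>{1..n}. x i \<le> y i"
  then show "alternating_list n x \<le> alternating_list n y"
    by (intro alternating_list_mono) (auto dest: cube_values)
qed

lemma alternating_list_halves:
  "even n \<Longrightarrow> restrict_plus n (alternating_list (Suc n)) = (\<lambda>_. 1)"
  "even n \<Longrightarrow> restrict_minus n (alternating_list (Suc n)) = alternating_list n"
  "odd n \<Longrightarrow> restrict_plus n (alternating_list (Suc n)) = alternating_list n"
  "odd n \<Longrightarrow> restrict_minus n (alternating_list (Suc n)) = (\<lambda>_. -1)"
  by (auto simp: restrict_plus_def restrict_minus_def fun_eq_iff alternating_list_update)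

declare alternating_list.simps [simp del]

lemma mean_alternating_list_0: "fourier_coeff 0 (alternating_list 0) {} = -1"
  by (simp add: fourier_coeff_def cube_def alternating_list.simps)

lemma mean_alternating_list_Suc:
  "fourier_coeff (Suc n) (alternating_list (Suc n)) {}
     = ((-1) ^ n + fourier_coeff n (alternating_list n) {}) / 2"
  by (cases "even n")
    (simp_all add: fourier_coeff_Suc alternating_list_halves fourier_coeff_const)

text \<open>The mean always has the sign opposite to that of the value forced by the next step, so
  averaging with this value cannot drive it towards \<open>\<plusminus>1\<close>.  The case \<open>n = 0\<close>, with mean \<open>-1\<close>, is
  the only exception to the bound \<open>1/2\<close>.\<close>

lemma mean_alternating_list:
  "- ((-1) ^ Suc n) * fourier_coeff (Suc n) (alternating_list (Suc n)) {} \<in> {0..1/2}"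
proof (induction n)
  case 0
  then show ?case
    unfolding mean_alternating_list_Suc by (simp add: mean_alternating_list_0)
next
  case (Suc n)
  then show ?case
    unfolding mean_alternating_list_Suc[of "Suc n"] by (cases "even n") auto
qed

lemma abs_mean_alternating_list:
  "\<bar>fourier_coeff (Suc n) (alternating_list (Suc n)) {}\<bar> \<le> 1/2"
  using mean_alternating_list[of n] by (cases "even n") auto

lemma spectral_norm_alternating_list_Suc:
  assumes "\<bar>fourier_coeff n (alternating_list n) {}\<bar> \<le> 1"
  shows "spectral_norm (Suc n) (alternating_list (Suc n))
           = spectral_norm n (alternating_list n) + 1 - \<bar>fourier_coeff n (alternating_list n) {}\<bar>"
proof (cases "even n")
  case True
  then show ?thesis
    unfolding spectral_norm_Suc using sum_max_unit_mass[OF assms, of 1]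
    by (simp only: alternating_list_halves)
next
  case False
  then show ?thesis
    unfolding spectral_norm_Suc using sum_max_unit_mass[OF assms, of "-1"]
    by (subst max.commute) (simp add: alternating_list_halves)
qed

lemma spectral_norm_alternating_list:
  "spectral_norm (Suc n) (alternating_list (Suc n)) \<ge> 1 + real n / 2"
proof (induction n)
  case 0
  show ?case
    using spectral_norm_alternating_list_Suc[of 0]
    by (simp add: spectral_norm_def mean_alternating_list_0)
next
  case (Suc n)
  then show ?case
    using spectral_norm_alternating_list_Suc[of "Suc n"] abs_mean_alternating_list[of n]
    by (simp add: field_simps)
qed

section \<open>Lowering a monotone function at a minimal true point\<close>

lemma ex_minimal_true_point:
  assumes "x \<in> cube n" "f x = (1::real)"
  obtains p where "p \<in> cube n" "f p = 1"
    and "\<And>y. y \<in> cube n \<Longrightarrow> f y = 1 \<Longrightarrow> \<forall>i\<in>{1..n}. y i \<le> p i \<Longrightarrow> y = p"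
proof -
  have "finite {x \<in> cube n. f x = 1}" "{x \<in> cube n. f x = 1} \<noteq> {}" using assms by auto
  from finite_has_minimal[OF this] obtain p where
    p: "p \<in> cube n" "f p = 1" "\<And>y. y \<in> cube n \<Longrightarrow> f y = 1 \<Longrightarrow> y \<le> p \<Longrightarrow> p = y"
    by auto
  have "y = p" if "y \<in> cube n" "f y = 1" "\<forall>i\<in>{1..n}. y i \<le> p i" for y
  proof -
    \<comment> \<open>Points of the cube agree outside \<open>{1..n}\<close>, so the coordinatewise order is the pointwise one.\<close>
    have "y i \<le> p i" for i
      using that(3) cube_outside[OF that(1), of i] cube_outside[OF p(1), of i]
      by (cases "i \<in> {1..n}") auto
    then show ?thesis using p(3)[OF that(1,2)] by (simp add: le_fun_def)
  qed
  with p(1,2) show thesis by (rule that)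
qed

text \<open>The restriction turns a point of \<open>cube (Suc n)\<close> into a genuine point of \<open>cube n\<close>, so that \<open>f\<close>
  is only evaluated where it is controlled.\<close>

definition lower_at :: "nat \<Rightarrow> (nat \<Rightarrow> real) \<Rightarrow> ((nat \<Rightarrow> real) \<Rightarrow> real) \<Rightarrow> (nat \<Rightarrow> real) \<Rightarrow> real" where
  "lower_at n p f x =
     (if x (Suc n) = -1 \<and> restrict x {1..n} = p then -1 else f (restrict x {1..n}))"

lemma lower_at_halves:
  assumes "x \<in> cube n"
  shows "restrict_plus n (lower_at n p f) x = f x"
    and "restrict_minus n (lower_at n p f) x = (if x = p then -1 else f x)"
  using restrict_cube_update[OF assms]
  by (simp_all add: restrict_plus_def restrict_minus_def lower_at_def)

lemma monotone_lower_at: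
  assumes f: "monotone_boolean_function n f"
    and p: "\<And>y. y \<in> cube n \<Longrightarrow> f y = 1 \<Longrightarrow> \<forall>i\<in>{1..n}. y i \<le> p i \<Longrightarrow> y = p"
  shows "monotone_boolean_function (Suc n) (lower_at n p f)"
  unfolding monotone_boolean_function_def boolean_function_def
proof (intro conjI ballI impI)
  have range_f: "f x \<in> {-1, 1}" if "x \<in> cube n" for x
    using f that by (auto simp: monotone_boolean_function_def boolean_function_def)
  show "lower_at n p f \<in> cube (Suc n) \<rightarrow> {-1, 1}"
    using range_f cube_restrict by (auto simp: lower_at_def)
  fix x y assume xy: "x \<in> cube (Suc n)" "y \<in> cube (Suc n)" "\<forall>i\<in>{1..Suc n}. x i \<le> y i"
  let ?x = "restrict x {1..n}" and ?y = "restrict y {1..n}"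
  have cube: "?x \<in> cube n" "?y \<in> cube n" using xy cube_restrict by auto
  have le: "\<forall>i\<in>{1..n}. ?x i \<le> ?y i" using xy by auto
  have mono: "f ?x \<le> f ?y"
    using f cube le by (auto simp: monotone_boolean_function_def)
  show "lower_at n p f x \<le> lower_at n p f y"
  proof (cases "y (Suc n) = -1 \<and> ?y = p")
    case True
    \<comment> \<open>Below the lowered point, minimality leaves only the value \<open>-1\<close>.\<close>
    have "x (Suc n) \<le> y (Suc n)" using xy(3) by simp
    with True have last: "x (Suc n) = -1" using cube_values[OF xy(1), of "Suc n"] by auto
    have "f ?x = -1" if "?x \<noteq> p"
      using p[OF cube(1)] le True range_f[OF cube(1)] that by auto
    then show ?thesis using last True by (auto simp: lower_at_def)
  next
    case False
    then show ?thesis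
      using mono range_f[OF cube(2)] by (auto simp: lower_at_def)
  qed
qed

lemma abs_character_cube:
  assumes "x \<in> cube n" "S \<subseteq> {1..n}"
  shows "\<bar>\<Prod>i\<in>S. x i\<bar> = 1"
proof -
  have "\<bar>x i\<bar> = 1" if "i \<in> S" for i
  proof -
    have "i \<in> {1..n}" using assms(2) that by blast
    from cube_values[OF assms(1) this] show ?thesis by auto
  qed
  then show ?thesis by (simp add: abs_prod)
qed

lemma fourier_coeff_lower_point:
  assumes p: "p \<in> cube n" "f p = 1"
  shows "fourier_coeff n (\<lambda>x. if x = p then -1 else f x) S
           = fourier_coeff n f S - 2 * (\<Prod>i\<in>S. p i) / 2 ^ n"
proof -
  have "(\<Sum>x\<in>cube n. (if x = p then -1 else f x) * (\<Prod>i\<in>S. x i))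
      = (\<Sum>x\<in>cube n. f x * (\<Prod>i\<in>S. x i) - (if x = p then 2 * (\<Prod>i\<in>S. p i) else 0))"
    by (rule sum.cong) (use p in auto)
  also have "\<dots> = (\<Sum>x\<in>cube n. f x * (\<Prod>i\<in>S. x i)) - 2 * (\<Prod>i\<in>S. p i)"
    using p by (simp add: sum_subtractf)
  finally show ?thesis by (simp add: fourier_coeff_def diff_divide_distrib)
qed

text \<open>With \<open>d = \<plusminus>1 / 2 ^ n\<close> the coefficients of the two halves are \<open>a\<close> and \<open>a - 2 d\<close>, and
  \<open>\<bar>a\<^sup>2 - (a - 2 d)\<^sup>2\<bar> = 4 \<bar>d\<bar> \<bar>a - d\<bar>\<close>.  Summed over the \<open>2 ^ n\<close> sets \<open>S\<close>, the loss from replacing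
  \<open>\<bar>a - d\<bar>\<close> by \<open>\<bar>a\<bar> - \<bar>d\<bar>\<close> is \<open>1\<close> in the spectral norm.\<close>

lemma split_at_minimal_true_point:
  fixes f :: "(nat \<Rightarrow> real) \<Rightarrow> real"
  assumes p: "p \<in> cube n" "f p = 1"
  defines "a \<equiv> fourier_coeff n (restrict_plus n (lower_at n p f))"
    and "b \<equiv> fourier_coeff n (restrict_minus n (lower_at n p f))"
  shows "(\<Sum>S\<in>Pow {1..n}. \<bar>a S - b S\<bar>\<^sup>2) = 4 / 2 ^ n"
    and "(\<Sum>S\<in>Pow {1..n}. \<bar>(a S)\<^sup>2 - (b S)\<^sup>2\<bar>) \<ge> (spectral_norm n f - 1) * (4 / 2 ^ n)"
proof -
  define d where "d S = (\<Prod>i\<in>S. p i) / 2 ^ n" for S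
  have abs_d: "\<bar>d S\<bar> = 1 / 2 ^ n" if "S \<in> Pow {1..n}" for S
    using abs_character_cube[OF p(1)] that by (simp add: d_def)
  have a: "a S = fourier_coeff n f S" for S
    unfolding a_def by (rule fourier_coeff_cong) (simp add: lower_at_halves)
  have "b S = fourier_coeff n (\<lambda>x. if x = p then -1 else f x) S" for S
    unfolding b_def by (rule fourier_coeff_cong) (simp add: lower_at_halves)
  then have b: "b S = a S - 2 * d S" for S
    using fourier_coeff_lower_point[where f = f, OF p] by (simp add: a d_def)
  have "\<bar>a S - b S\<bar>\<^sup>2 = 4 / 2 ^ n * (1 / 2 ^ n)" if "S \<in> Pow {1..n}" for S
  proof -
    have "\<bar>a S - b S\<bar>\<^sup>2 = 4 * \<bar>d S\<bar>\<^sup>2" by (simp add: b power_mult_distrib)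
    then show ?thesis by (simp add: abs_d[OF that] power2_eq_square)
  qed
  then show "(\<Sum>S\<in>Pow {1..n}. \<bar>a S - b S\<bar>\<^sup>2) = 4 / 2 ^ n"
    by (simp add: card_Pow)
  have term_ge: "4 / 2 ^ n * (\<bar>a S\<bar> - 1 / 2 ^ n) \<le> \<bar>(a S)\<^sup>2 - (b S)\<^sup>2\<bar>"
    if "S \<in> Pow {1..n}" for S
  proof -
    have "(a S)\<^sup>2 - (b S)\<^sup>2 = 4 * d S * (a S - d S)"
      by (simp add: b power2_eq_square algebra_simps)
    then have "\<bar>(a S)\<^sup>2 - (b S)\<^sup>2\<bar> = 4 / 2 ^ n * \<bar>a S - d S\<bar>"
      by (simp add: abs_mult abs_d[OF that])
    moreover have "\<bar>a S\<bar> - 1 / 2 ^ n \<le> \<bar>a S - d S\<bar>"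
      using abs_triangle_ineq2[of "a S" "d S"] by (simp add: abs_d[OF that])
    ultimately show ?thesis by (simp add: divide_right_mono)
  qed
  have "(spectral_norm n f - 1) * (4 / 2 ^ n)
      = (\<Sum>S\<in>Pow {1..n}. 4 / 2 ^ n * (\<bar>a S\<bar> - 1 / 2 ^ n))"
    unfolding sum_distrib_left[symmetric] sum_subtractf spectral_norm_def a
    by (simp add: card_Pow)
  also have "\<dots> \<le> (\<Sum>S\<in>Pow {1..n}. \<bar>(a S)\<^sup>2 - (b S)\<^sup>2\<bar>)"
    by (rule sum_mono) (rule term_ge)
  finally show "(\<Sum>S\<in>Pow {1..n}. \<bar>(a S)\<^sup>2 - (b S)\<^sup>2\<bar>) \<ge> (spectral_norm n f - 1) * (4 / 2 ^ n)" .
qed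

section \<open>The ratio of the two sums is unbounded\<close>

theorem proposition5p1:
  fixes K :: real
  assumes "K > 0"
  shows "\<exists>(n::nat) (F :: (nat \<Rightarrow> real) \<Rightarrow> real). n > 0 \<and> monotone_boolean_function (n + 1) F \<and>
    (\<Sum>S\<in>Pow {1..n}. \<bar>(fourier_coeff n (restrict_plus n F) S)\<^sup>2
                          - (fourier_coeff n (restrict_minus n F) S)\<^sup>2\<bar>)
    > K * (\<Sum>S\<in>Pow {1..n}. \<bar>fourier_coeff n (restrict_plus n F) S
                          - fourier_coeff n (restrict_minus n F) S\<bar>\<^sup>2)"
proof -
  obtain m :: nat where m: "2 * K < real m" using reals_Archimedean2 by blast
  define n where "n = Suc m"
  let ?f = "alternating_list n"
  define top :: "nat \<Rightarrow> real" where "top = restrict (\<lambda>_. 1) {1..n}"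
  have top: "top \<in> cube n" by (auto simp: top_def cube_def)
  \<comment> \<open>At the all-ones point the first variable, if no other one, forces the value \<open>1\<close>.\<close>
  have "alternating_list (Suc k) x = 1" if "\<And>i. i \<in> {1..Suc k} \<Longrightarrow> x i = 1" for k x
    using that by (induction k) (auto simp: alternating_list.simps minus_one_power_iff)
  then have "?f top = 1" by (simp add: n_def top_def)
  from ex_minimal_true_point[where f = ?f, OF top this] obtain p where p: "p \<in> cube n" "?f p = 1"
    and minimal: "\<And>y. y \<in> cube n \<Longrightarrow> ?f y = 1 \<Longrightarrow> \<forall>i\<in>{1..n}. y i \<le> p i \<Longrightarrow> y = p"
    by blast
  let ?F = "lower_at n p ?f"
  have "K < spectral_norm n ?f - 1"
    using spectral_norm_alternating_list[of m] m by (simp add: n_def)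
  then have "K * (4 / 2 ^ n) < (spectral_norm n ?f - 1) * (4 / 2 ^ n)"
    by (intro mult_strict_right_mono) auto
  then have "K * (\<Sum>S\<in>Pow {1..n}. \<bar>fourier_coeff n (restrict_plus n ?F) S
                          - fourier_coeff n (restrict_minus n ?F) S\<bar>\<^sup>2)
      < (\<Sum>S\<in>Pow {1..n}. \<bar>(fourier_coeff n (restrict_plus n ?F) S)\<^sup>2
                          - (fourier_coeff n (restrict_minus n ?F) S)\<^sup>2\<bar>)"
    unfolding split_at_minimal_true_point(1)[where f = ?f, OF p]
    using split_at_minimal_true_point(2)[where f = ?f, OF p] by (rule less_le_trans)
  moreover have "monotone_boolean_function (n + 1) ?F"
    using monotone_lower_at[OF monotone_alternating_list minimal] by simp
  moreover have "n > 0" by (simp add: n_def)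
  ultimately show ?thesis by blast
qed

end
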